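(* For all non-negative integers $a,b,c,d,m,n,p,r$, the star product $\star$ on $\mathbb{C}_q[t_{41},t_{42},t_{31},t_{32}]$ defined in the context satisfies $$\begin{aligned} (t_{41}^a t_{42}^b t_{31}^c t_{32}^d)\star(t_{41}^m t_{42}^n t_{31}^p t_{32}^r)={}& q^{-mc-mb-nd-dp}\,t_{41}^{a+m}t_{42}^{b+n}t_{31}^{c+p}t_{32}^{d+r}\\ &+\sum_{k=1}^{\min(d,m)} q^{-(m-k)c-(m-k)b-n(d-k)-p(d-k)}\,F_k(q,d,m)\,t_{41}^{a+m-k}t_{42}^{b+k+n}t_{31}^{c+k+p}t_{32}^{d-k+r}. \end{aligned}$$
   Context: Let $\mathbb{C}_q=\mathbb{C}[q,q^{-1}]$. The quantum Minkowski space $\mathcal{O}_q(\mathrm{M})$ is the associative unital $\mathbb{C}_q$-algebra generated by $\hat t_{41},\hat t_{42},\hat t_{31},\hat t_{32}$ subject to the relations $$\hat t_{42}\hat t_{41}=q^{-1}\hat t_{41}\hat t_{42},\quad \hat t_{31}\hat t_{41}=q^{-1}\hat t_{41}\hat t_{31},\quad \hat t_{32}\hat t_{41}=\hat t_{41}\hat t_{32}+(q^{-1}-q)\hat t_{42}\hat t_{31},$$ $$\hat t_{31}\hat t_{42}=\hat t_{42}\hat t_{31},\quad \hat t_{32}\hat t_{42}=q^{-1}\hat t_{42}\hat t_{32},\quad \hat t_{32}\hat t_{31}=q^{-1}\hat t_{31}\hat t_{32}.$$ It is known that the $\mathbb{C}_q$-linear map $$Q:\mathbb{C}_q[t_{41},t_{42},t_{31},t_{32}]\to\mathcal{O}_q(\mathrm{M}),\qquad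 t_{41}^a t_{42}^b t_{31}^c t_{32}^d\mapsto \hat t_{41}^a\hat t_{42}^b\hat t_{31}^c\hat t_{32}^d,$$ from the commutative polynomial ring is an isomorphism of $\mathbb{C}_q$-modules. The star product is $f\star g=Q^{-1}(Q(f)Q(g))$ for $f,g\in\mathbb{C}_q[t_{41},t_{42},t_{31},t_{32}]$. Coefficients: $F(q,n)=q^{-(2n-1)}-q$. The elements $\beta_k(q,m)\in\mathbb{C}_q$ ($m\ge 0$) are defined by $\beta_0(q,m)=\beta_m(q,m)=1$, $\beta_k(q,m)=0$ if $k<0$ or $k>m$, and $\beta_k(q,m+1)=\beta_{k-1}(q,m)+q^{-2k}\beta_k(q,m)$. Finally $$F_k(q,m,n)=\beta_k(q,m)\prod_{l=0}^{k-1}F(q,n-l).$$ *)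

theory Defs
  imports Complex_Main "HOL-Library.Poly_Mapping"
begin

text \<open>The ring of Laurent polynomials \<open>\<complex>[q, q\<^sup>-\<^sup>1]\<close>, as the monoid algebra of
  \<open>(\<int>, +)\<close> over \<open>\<complex>\<close>: \<open>qpow k\<close> is the Laurent monomial \<open>q\<^sup>k\<close>.\<close>

type_synonym Cq = "int \<Rightarrow>\<^sub>0 complex"

definition qpow :: "int \<Rightarrow> Cq" where
  "qpow k = Poly_Mapping.single k 1"

lemma qpow_0 [simp]: "qpow 0 = 1"
  by (simp add: qpow_def)

lemma qpow_add: "qpow (j + k) = qpow j * qpow k"
  by (simp add: qpow_def mult_single)


text \<open>The four indices \<open>41, 42, 31, 32\<close>, shared by the commuting variables \<open>t\<close> and the
  noncommuting generators \<open>that\<close>.\<close>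

datatype gen = G41 | G42 | G31 | G32


subsection \<open>The commutative polynomial ring\<close>

type_synonym cpoly = "(gen \<Rightarrow>\<^sub>0 nat) \<Rightarrow>\<^sub>0 Cq"

definition t :: "gen \<Rightarrow> cpoly" where
  "t g = Poly_Mapping.single (Poly_Mapping.single g 1) 1"

definition cconst :: "Cq \<Rightarrow> cpoly" where
  "cconst c = Poly_Mapping.single 0 c"


subsection \<open>The free associative algebra\<close>

text \<open>The free monoid on \<open>'a\<close>, written additively because \<open>Poly_Mapping\<close> forms monoid algebras
  over additive monoids. A new type leaves the type \<open>list\<close> without an arithmetic instance.\<close>

datatype 'a fmon = FMon (letters: "'a list")

instantiation fmon :: (type) monoid_add
begin

definition "0 = FMon []"
definition "u + v = FMon (letters u @ letters v)"

instance
  by standard (auto simp: zero_fmon_def plus_fmon_def)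

end

lemma fmon_add_eq_0_iff: "(u :: 'a fmon) + v = 0 \<longleftrightarrow> u = 0 \<and> v = 0"
  by (cases u; cases v) (auto simp: zero_fmon_def plus_fmon_def)

type_synonym falg = "gen fmon \<Rightarrow>\<^sub>0 Cq"

definition fgen :: "gen \<Rightarrow> falg" where
  "fgen g = Poly_Mapping.single (FMon [g]) 1"

definition fconst :: "Cq \<Rightarrow> falg" where
  "fconst c = Poly_Mapping.single 0 c"

lemma fconst_central: "fconst c * x = x * fconst c"
proof (rule poly_mapping_eqI)
  fix k :: "gen fmon"
  have a: "Poly_Mapping.lookup (fconst c * x) k = c * Poly_Mapping.lookup x k"
    unfolding fconst_def mult_map_scale_conv_mult[symmetric]
    by (simp add: map.rep_eq when_def)
  have b: "(\<Sum>u. Poly_Mapping.lookup (fconst c) u when k = l + u) = (c when k = l)" for l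
  proof -
    have "(\<lambda>u. Poly_Mapping.lookup (fconst c) u when k = l + u) = (\<lambda>u. (c when k = l) when u = 0)"
      by (auto simp: fconst_def lookup_single when_def fun_eq_iff)
    then show ?thesis by (simp only: Sum_any_when_equal)
  qed
  have "Poly_Mapping.lookup (x * fconst c) k = (\<Sum>l. Poly_Mapping.lookup x l * (c when k = l))"
    by (simp only: lookup_mult b)
  also have "\<dots> = (\<Sum>l. (Poly_Mapping.lookup x l * c) when l = k)"
    by (rule Sum_any.cong) (auto simp: when_def)
  also have "\<dots> = c * Poly_Mapping.lookup x k"
    by (simp add: mult.commute)
  finally show "Poly_Mapping.lookup (fconst c * x) k = Poly_Mapping.lookup (x * fconst c) k"
    by (simp add: a)
qed


subsection \<open>The quantum Minkowski space\<close>

inductive_set two_sided_ideal :: "'a::ring_1 set \<Rightarrow> 'a set" for S where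
  gen: "s \<in> S \<Longrightarrow> s \<in> two_sided_ideal S"
| zero: "0 \<in> two_sided_ideal S"
| add: "x \<in> two_sided_ideal S \<Longrightarrow> y \<in> two_sided_ideal S \<Longrightarrow> x + y \<in> two_sided_ideal S"
| mult: "x \<in> two_sided_ideal S \<Longrightarrow> a * x * b \<in> two_sided_ideal S"

lemma two_sided_ideal_uminus: "x \<in> two_sided_ideal S \<Longrightarrow> - x \<in> two_sided_ideal S"
  using two_sided_ideal.mult[of x S "-1" 1] by simp

lemma two_sided_ideal_left: "x \<in> two_sided_ideal S \<Longrightarrow> a * x \<in> two_sided_ideal S"
  using two_sided_ideal.mult[of x S a 1] by simp

lemma two_sided_ideal_right: "x \<in> two_sided_ideal S \<Longrightarrow> x * b \<in> two_sided_ideal S"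
  using two_sided_ideal.mult[of x S 1 b] by simp

definition minkowski_rels :: "falg set" where
  "minkowski_rels =
    {fgen G42 * fgen G41 - fconst (qpow (-1)) * fgen G41 * fgen G42,
     fgen G31 * fgen G41 - fconst (qpow (-1)) * fgen G41 * fgen G31,
     fgen G32 * fgen G41 -
       (fgen G41 * fgen G32 + fconst (qpow (-1) - qpow 1) * fgen G42 * fgen G31),
     fgen G31 * fgen G42 - fgen G42 * fgen G31,
     fgen G32 * fgen G42 - fconst (qpow (-1)) * fgen G42 * fgen G32,
     fgen G32 * fgen G31 - fconst (qpow (-1)) * fgen G31 * fgen G32}"

text \<open>The ideal is proper, since the augmentation \<open>\<lambda>x. Poly_Mapping.lookup x 0\<close> vanishes on it; this is needed
  for the quotient to be an instance of \<open>ring_1\<close>, which includes \<open>0 \<noteq> 1\<close>.\<close>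

lemma lookup_mult_0: "Poly_Mapping.lookup (x * y) 0 = Poly_Mapping.lookup x 0 * Poly_Mapping.lookup y 0" for x y :: falg
proof -
  have inner: "(\<Sum>v. Poly_Mapping.lookup y v when 0 = u + v) = (Poly_Mapping.lookup y 0 when u = 0)" for u :: "gen fmon"
  proof -
    have "(\<lambda>v. Poly_Mapping.lookup y v when 0 = u + v) = (\<lambda>v. (Poly_Mapping.lookup y 0 when u = 0) when v = 0)"
      using fmon_add_eq_0_iff[of u] by (auto simp: when_def fun_eq_iff eq_commute[of 0])
    then show ?thesis by (simp only: Sum_any_when_equal)
  qed
  have "Poly_Mapping.lookup (x * y) 0 = (\<Sum>u. Poly_Mapping.lookup x u * (Poly_Mapping.lookup y 0 when u = 0))"
    by (simp only: lookup_mult inner)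
  also have "\<dots> = (\<Sum>u::gen fmon. (Poly_Mapping.lookup x 0 * Poly_Mapping.lookup y 0) when u = 0)"
    by (rule Sum_any.cong) (auto simp: when_def)
  finally show ?thesis by simp
qed

lemma lookup_fgen_0 [simp]: "Poly_Mapping.lookup (fgen g) 0 = 0"
  by (simp add: fgen_def lookup_single zero_fmon_def)

lemma ideal_augmentation: "x \<in> two_sided_ideal minkowski_rels \<Longrightarrow> Poly_Mapping.lookup x 0 = 0"
  by (induction rule: two_sided_ideal.induct)
    (auto simp: minkowski_rels_def lookup_mult_0 lookup_add lookup_minus)

quotient_type qmink = falg / "\<lambda>x y. x - y \<in> two_sided_ideal minkowski_rels"
proof (rule equivpI)
  show "reflp (\<lambda>x y. x - y \<in> two_sided_ideal minkowski_rels)"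
    by (simp add: reflp_def two_sided_ideal.zero)
  show "symp (\<lambda>x y. x - y \<in> two_sided_ideal minkowski_rels)"
    by (metis (no_types, lifting) minus_diff_eq sympI two_sided_ideal_uminus)
  show "transp (\<lambda>x y. x - y \<in> two_sided_ideal minkowski_rels)"
  proof (rule transpI)
    fix x y z :: falg
    assume "x - y \<in> two_sided_ideal minkowski_rels" "y - z \<in> two_sided_ideal minkowski_rels"
    from two_sided_ideal.add[OF this] show "x - z \<in> two_sided_ideal minkowski_rels" by simp
  qed
qed

instantiation qmink :: ring_1
begin

lift_definition zero_qmink :: qmink is 0 .
lift_definition one_qmink :: qmink is 1 .

lift_definition plus_qmink :: "qmink \<Rightarrow> qmink \<Rightarrow> qmink" is "(+)"
proof -
  fix a b c d :: falg
  assume "a - b \<in> two_sided_ideal minkowski_rels" "c - d \<in> two_sided_ideal minkowski_rels"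
  from two_sided_ideal.add[OF this]
  show "a + c - (b + d) \<in> two_sided_ideal minkowski_rels" by (simp add: algebra_simps)
qed

lift_definition uminus_qmink :: "qmink \<Rightarrow> qmink" is uminus
proof -
  fix a b :: falg
  assume "a - b \<in> two_sided_ideal minkowski_rels"
  from two_sided_ideal_uminus[OF this]
  show "- a - - b \<in> two_sided_ideal minkowski_rels" by simp
qed

lift_definition minus_qmink :: "qmink \<Rightarrow> qmink \<Rightarrow> qmink" is "(-)"
proof -
  fix a b c d :: falg
  assume "a - b \<in> two_sided_ideal minkowski_rels" "c - d \<in> two_sided_ideal minkowski_rels"
  from two_sided_ideal.add[OF this(1) two_sided_ideal_uminus[OF this(2)]]
  show "a - c - (b - d) \<in> two_sided_ideal minkowski_rels" by (simp add: algebra_simps)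
qed

lift_definition times_qmink :: "qmink \<Rightarrow> qmink \<Rightarrow> qmink" is "(*)"
proof -
  fix a b c d :: falg
  assume "a - b \<in> two_sided_ideal minkowski_rels" "c - d \<in> two_sided_ideal minkowski_rels"
  from two_sided_ideal.add[OF two_sided_ideal_right[OF this(1), of c]
      two_sided_ideal_left[OF this(2), of b]]
  show "a * c - b * d \<in> two_sided_ideal minkowski_rels" by (simp add: algebra_simps)
qed

instance
proof
  show "(0 :: qmink) \<noteq> 1"
    by transfer (auto dest!: ideal_augmentation simp: lookup_minus)
qed (transfer; simp add: algebra_simps two_sided_ideal.zero)+

end

lift_definition that :: "gen \<Rightarrow> qmink" is fgen .

lift_definition qconst :: "Cq \<Rightarrow> qmink" is fconst .

lemma qconst_central: "qconst c * x = x * qconst c"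
  by transfer (simp add: fconst_central two_sided_ideal.zero)

lemma qconst_add: "qconst (c + d) = qconst c + qconst d"
  by transfer (simp add: fconst_def single_add two_sided_ideal.zero)

lemma qconst_mult: "qconst (c * d) = qconst c * qconst d"
  by transfer (simp add: fconst_def mult_single two_sided_ideal.zero)

lemma qconst_1 [simp]: "qconst 1 = 1"
  by transfer (simp add: fconst_def two_sided_ideal.zero)

lemma qconst_0 [simp]: "qconst 0 = 0"
  by transfer (simp add: fconst_def two_sided_ideal.zero)

lemma that_relations:
  "that G42 * that G41 = qconst (qpow (-1)) * that G41 * that G42"
  "that G31 * that G41 = qconst (qpow (-1)) * that G41 * that G31"
  "that G32 * that G41 =
     that G41 * that G32 + qconst (qpow (-1) - qpow 1) * that G42 * that G31"
  "that G31 * that G42 = that G42 * that G31"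
  "that G32 * that G42 = qconst (qpow (-1)) * that G42 * that G32"
  "that G32 * that G31 = qconst (qpow (-1)) * that G31 * that G32"
  by (transfer; rule two_sided_ideal.gen; simp add: minkowski_rels_def)+


subsection \<open>The ordering map and the star product\<close>

definition Q :: "cpoly \<Rightarrow> qmink" where
  "Q f = (\<Sum>e\<in>Poly_Mapping.keys f. qconst (Poly_Mapping.lookup f e) *
     (that G41 ^ Poly_Mapping.lookup e G41 * that G42 ^ Poly_Mapping.lookup e G42 *
      that G31 ^ Poly_Mapping.lookup e G31 * that G32 ^ Poly_Mapping.lookup e G32))"

lemma Q_add: "Q (f + g) = Q f + Q g"
  unfolding Q_def
  by (rule setsum_keys_plus_distrib) (simp_all add: qconst_add distrib_right)

lemma Q_cconst_mult: "Q (cconst c * f) = qconst c * Q f"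
proof -
  have look: "Poly_Mapping.lookup (cconst c * f) e = c * Poly_Mapping.lookup f e" for e
    unfolding cconst_def mult_map_scale_conv_mult[symmetric] by (simp add: map.rep_eq when_def)
  let ?T = "\<lambda>e. that G41 ^ Poly_Mapping.lookup e G41 * that G42 ^ Poly_Mapping.lookup e G42 *
      that G31 ^ Poly_Mapping.lookup e G31 * that G32 ^ Poly_Mapping.lookup e G32"
  have "Q (cconst c * f) = (\<Sum>e\<in>Poly_Mapping.keys f. qconst (Poly_Mapping.lookup (cconst c * f) e) * ?T e)"
    unfolding Q_def
    by (rule sum.mono_neutral_left) (auto simp: in_keys_iff look)
  then show ?thesis
    by (simp add: look Q_def qconst_mult sum_distrib_left mult.assoc)
qed

lemma t_power: "t g ^ n = Poly_Mapping.single (Poly_Mapping.single g n) 1"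
  by (induction n) (simp_all add: t_def mult_single single_add[symmetric])

lemma Q_monomial:
  "Q (t G41 ^ a * t G42 ^ b * t G31 ^ c * t G32 ^ d) =
     that G41 ^ a * that G42 ^ b * that G31 ^ c * that G32 ^ d"
  by (simp add: t_power mult_single Q_def lookup_add lookup_single)

text \<open>\<open>inv Q\<close> is a genuine inverse because \<open>Q\<close> is bijective: the ordered monomials form a basis
  of the quantum Minkowski space. This known fact is not proved here.\<close>

definition star :: "cpoly \<Rightarrow> cpoly \<Rightarrow> cpoly" (infixl \<open>\<star>\<close> 70) where
  "f \<star> g = inv Q (Q f * Q g)"


subsection \<open>The coefficients\<close>

definition F :: "int \<Rightarrow> Cq" where
  "F n = qpow (- (2 * n - 1)) - qpow 1"

text \<open>The recursion alone, started at \<open>m = 0\<close>, determines all \<open>\<beta>\<^sub>k(q,m)\<close>; the remaining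
  defining equations are \<open>beta_eq_1\<close> and \<open>beta_eq_0\<close> below.\<close>

fun beta :: "int \<Rightarrow> nat \<Rightarrow> Cq" where
  "beta k 0 = (if k = 0 then 1 else 0)"
| "beta k (Suc m) = beta (k - 1) m + qpow (- 2 * k) * beta k m"

lemma beta_eq_0: "k < 0 \<or> k > int m \<Longrightarrow> beta k m = 0"
  by (induction m arbitrary: k) auto

lemma beta_eq_1: "beta 0 m = 1" "beta (int m) m = 1"
  by (induction m) (auto simp: beta_eq_0)

definition Fk :: "nat \<Rightarrow> nat \<Rightarrow> nat \<Rightarrow> Cq" where
  "Fk k m n = beta (int k) m * (\<Prod>l<k. F (int n - int l))"

end

theory Submission
  imports Defs
begin

text \<open>Commuting \<open>that G32\<close> past \<open>that G41 ^ m\<close> produces the coefficient \<open>F m\<close>; iterating this and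
  moving the remaining generators past each other, which only costs powers of \<open>q\<close>, writes the
  product of two ordered monomials as the image under \<open>Q\<close> of the claimed polynomial. To cancel
  \<open>Q\<close> we need it to be injective. For this, the free algebra acts from the right on functions
  \<open>\<phi>\<close> on \<open>\<nat>\<^sup>4\<close> by the transposes of the left multiplication operators in the expected basis of
  ordered monomials. The relations act by zero, and the value at the origin of \<open>\<phi>\<close> acted upon by
  the ordered monomial with exponents \<open>a, b, c, d\<close> is \<open>\<phi> a b c d\<close>, which recovers all
  coefficients of \<open>f\<close> from \<open>Q f\<close>.\<close>

subsection \<open>Injectivity of the ordering map\<close>

type_synonym exponent_fun = "nat \<Rightarrow> nat \<Rightarrow> nat \<Rightarrow> nat \<Rightarrow> Cq"

text \<open>At \<open>a = 0\<close> the truncated \<open>a - 1\<close> is harmless because \<open>F 0 = 0\<close>.\<close>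

fun gen_act :: "gen \<Rightarrow> exponent_fun \<Rightarrow> exponent_fun" where
  "gen_act G41 \<phi> a b c d = \<phi> (a + 1) b c d"
| "gen_act G42 \<phi> a b c d = qpow (- int a) * \<phi> a (b + 1) c d"
| "gen_act G31 \<phi> a b c d = qpow (- int a) * \<phi> a b (c + 1) d"
| "gen_act G32 \<phi> a b c d = qpow (- int b - int c) * \<phi> a b c (d + 1)
     + F (int a) * \<phi> (a - 1) (b + 1) (c + 1) d"

lemma F_0 [simp]: "F 0 = 0"
  by (simp add: F_def)

text \<open>This recursion is the condition that the relation between \<open>G32\<close> and
  \<open>G41\<close> puts on the coefficient in \<open>gen_act G32\<close>. It also drives the
  induction for \<open>G32_G41_power\<close>.\<close>

lemma F_add_1: "F (1 + x) = F x + qpow (- 2 * x) * (qpow (- 1) - qpow 1)"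
  by (simp add: F_def algebra_simps flip: qpow_add)

section \<open>Extension of the action to the free algebra\<close>

lemma gen_act_linear:
  "gen_act g (\<lambda>a b c d. x * \<phi> a b c d + \<psi> a b c d) =
     (\<lambda>a b c d. x * gen_act g \<phi> a b c d + gen_act g \<psi> a b c d)"
  by (cases g) (auto simp: fun_eq_iff algebra_simps)

lemma fold_gen_act_linear:
  "fold gen_act w (\<lambda>a b c d. x * \<phi> a b c d + \<psi> a b c d) =
     (\<lambda>a b c d. x * fold gen_act w \<phi> a b c d + fold gen_act w \<psi> a b c d)"
  by (induction w arbitrary: \<phi> \<psi>) (simp_all add: gen_act_linear)

text \<open>\<open>fold\<close> applies the leftmost letter first, which makes this a right
  action.\<close>

definition falg_act :: "falg \<Rightarrow> exponent_fun \<Rightarrow> exponent_fun" where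
  "falg_act x \<phi> a b c d =
     (\<Sum>w\<in>Poly_Mapping.keys x. Poly_Mapping.lookup x w * fold gen_act (letters w) \<phi> a b c d)"

lemma falg_act_add:
  "falg_act (x + y) \<phi> a b c d = falg_act x \<phi> a b c d + falg_act y \<phi> a b c d"
  unfolding falg_act_def
  by (rule setsum_keys_plus_distrib) (simp_all add: algebra_simps)

lemma falg_act_single:
  "falg_act (Poly_Mapping.single w x) \<phi> a b c d = x * fold gen_act (letters w) \<phi> a b c d"
  by (simp add: falg_act_def)

lemma falg_act_0 [simp]: "falg_act 0 \<phi> a b c d = 0"
  by (simp add: falg_act_def)

lemma falg_act_uminus: "falg_act (- x) \<phi> a b c d = - falg_act x \<phi> a b c d"
  using falg_act_add[of x "- x" \<phi> a b c d] by (simp add: minus_unique)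

lemma falg_act_diff:
  "falg_act (x - y) \<phi> a b c d = falg_act x \<phi> a b c d - falg_act y \<phi> a b c d"
  using falg_act_add[of x "- y" \<phi> a b c d] by (simp add: falg_act_uminus)

lemma falg_act_linear:
  "falg_act y (\<lambda>a b c d. x * \<phi> a b c d + \<psi> a b c d) a b c d =
     x * falg_act y \<phi> a b c d + falg_act y \<psi> a b c d"
  unfolding falg_act_def fold_gen_act_linear
  by (simp add: sum.distrib sum_distrib_left algebra_simps)

lemma falg_act_zero_fun [simp]: "falg_act y (\<lambda>a b c d. 0) a b c d = 0"
  using falg_act_linear[of y 0 "\<lambda>a b c d. 0" "\<lambda>a b c d. 0" a b c d]
    falg_act_linear[of y 1 "\<lambda>a b c d. 0" "\<lambda>a b c d. 0" a b c d] by simp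

text \<open>Linearity reduces both factors to single words by nested inductions; for words, folding
  over a concatenation is composition.\<close>

lemma falg_act_mult: "falg_act (x * y) \<phi> = falg_act y (falg_act x \<phi>)"
proof (intro ext)
  fix a b c d
  show "falg_act (x * y) \<phi> a b c d = falg_act y (falg_act x \<phi>) a b c d"
  proof (induction x rule: update_induct)
    case const
    have "falg_act 0 \<phi> = (\<lambda>a b c d. 0)" by (simp add: fun_eq_iff)
    then show ?case by simp
  next
    case (update x u r)
    \<comment> \<open>Since \<open>u\<close> is not a key of \<open>x\<close>, the update is the
      addition of a monomial.\<close>
    have x: "Poly_Mapping.update u r x = Poly_Mapping.single u r + x"
      using update(1)
      by (intro poly_mapping_eqI) (auto simp: lookup_update lookup_add lookup_single in_keys_iff)
    have *: "falg_act (Poly_Mapping.single u r + x) \<phi> =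
        (\<lambda>a b c d. r * fold gen_act (letters u) \<phi> a b c d + falg_act x \<phi> a b c d)"
      by (simp add: fun_eq_iff falg_act_add falg_act_single)
    have "falg_act (Poly_Mapping.single u r * y) \<phi> a b c d =
        r * falg_act y (fold gen_act (letters u) \<phi>) a b c d"
    proof (induction y rule: update_induct)
      case (update y v s)
      have y: "Poly_Mapping.update v s y = Poly_Mapping.single v s + y"
        using update(1)
        by (intro poly_mapping_eqI) (auto simp: lookup_update lookup_add lookup_single in_keys_iff)
      show ?case
        unfolding y
        by (simp add: distrib_left falg_act_add falg_act_single mult_single update.IH
            plus_fmon_def algebra_simps)
    qed simp
    then show ?case
      unfolding x * falg_act_linear by (simp add: distrib_right falg_act_add update.IH)
  qed
qed

lemma falg_act_fgen: "falg_act (fgen g) = gen_act g"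
  by (intro ext) (simp add: fgen_def falg_act_single)

lemma falg_act_fconst: "falg_act (fconst x) \<phi> = (\<lambda>a b c d. x * \<phi> a b c d)"
  by (intro ext) (simp add: fconst_def falg_act_single zero_fmon_def)

text \<open>Only the relation between \<open>G32\<close> and \<open>G41\<close> needs more than
  bookkeeping of exponents: its terms in \<open>b + 1\<close>, \<open>c + 1\<close> cancel by
  \<open>F_add_1\<close>. Splitting on \<open>a\<close> resolves the truncated
  \<open>a - 1\<close>.\<close>

lemma falg_act_minkowski_rels:
  assumes "s \<in> minkowski_rels"
  shows "falg_act s \<phi> a b c d = 0"
proof -
  \<comment> \<open>These rules rewrite both sides in the same few Laurent monomials, so that ring
    normalization can compare them.\<close>
  have qpow_simps: "qpow (- 1 - x) = qpow (- x) * qpow (- 1)"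
      "qpow (- 2 - x) = qpow (- x) * qpow (- 1) * qpow (- 1)"
      "qpow (- 1 - x - y) = qpow (- x - y) * qpow (- 1)"
      "qpow (- x - (1 + y)) = qpow (- x - y) * qpow (- 1)"
      "qpow (- 2 * x) = qpow (- x) * qpow (- x)" for x y
    unfolding qpow_add[symmetric] by (intro arg_cong[where f = qpow]; simp)+
  have F_simps: "F 1 = qpow (- 1) - qpow 1"
      "F (1 + x) = F x + qpow (- x) * (qpow (- x) * (qpow (- 1) - qpow 1))"
      "F (2 + x) = F (1 + x) + qpow (- 1 - x) * (qpow (- 1 - x) * (qpow (- 1) - qpow 1))" for x
    using F_add_1[of 0] F_add_1[of x] F_add_1[of "1 + x"] qpow_simps(5)[of x] qpow_simps(5)[of "1 + x"]
    by (simp_all add: mult.assoc)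
  note act = falg_act_diff falg_act_add falg_act_mult falg_act_fgen falg_act_fconst
  show ?thesis
    using assms unfolding minkowski_rels_def
    by (elim insertE emptyE; hypsubst; cases a;
        simp add: act F_simps qpow_simps ring_distribs mult_ac)
qed

text \<open>The function varies in the induction because in \<open>a * x * b\<close> the element
  \<open>x\<close> acts on \<open>falg_act a \<phi>\<close>; then \<open>b\<close> acts on
  zero.\<close>

lemma falg_act_ideal: "x \<in> two_sided_ideal minkowski_rels \<Longrightarrow> falg_act x \<phi> = (\<lambda>a b c d. 0)"
proof (induction arbitrary: \<phi> rule: two_sided_ideal.induct)
  case (gen s)
  then show ?case by (intro ext falg_act_minkowski_rels)
next
  case (mult x a b)
  show ?case by (simp add: falg_act_mult mult.IH fun_eq_iff)
qed (simp_all add: fun_eq_iff falg_act_add)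

section \<open>Descent to the quantum Minkowski space\<close>

lift_definition qmink_act :: "qmink \<Rightarrow> exponent_fun \<Rightarrow> exponent_fun" is falg_act
proof (intro ext)
  fix x y :: falg and \<phi> a b c d
  assume "x - y \<in> two_sided_ideal minkowski_rels"
  then have "falg_act (x - y) \<phi> a b c d = 0" by (simp add: falg_act_ideal)
  then show "falg_act x \<phi> a b c d = falg_act y \<phi> a b c d" by (simp add: falg_act_diff)
qed

lemma qmink_act_0 [simp]: "qmink_act 0 \<phi> a b c d = 0"
  by (simp add: zero_qmink_def qmink_act.abs_eq)

lemma qmink_act_add:
  "qmink_act (x + y) \<phi> a b c d = qmink_act x \<phi> a b c d + qmink_act y \<phi> a b c d"
  by (induction x rule: qmink.abs_induct; induction y rule: qmink.abs_induct)
    (simp add: plus_qmink.abs_eq qmink_act.abs_eq falg_act_add)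

lemma qmink_act_sum: "qmink_act (sum f S) \<phi> a b c d = (\<Sum>i\<in>S. qmink_act (f i) \<phi> a b c d)"
  by (induction S rule: infinite_finite_induct) (simp_all add: qmink_act_add)

lemma qmink_act_mult: "qmink_act (x * y) \<phi> = qmink_act y (qmink_act x \<phi>)"
  by (induction x rule: qmink.abs_induct; induction y rule: qmink.abs_induct)
    (simp add: times_qmink.abs_eq qmink_act.abs_eq falg_act_mult)

lemma qmink_act_qconst: "qmink_act (qconst x) \<phi> = (\<lambda>a b c d. x * \<phi> a b c d)"
  by (simp add: qconst.abs_eq qmink_act.abs_eq falg_act_fconst)

lemma qmink_act_that: "qmink_act (that g) = gen_act g"
  by (simp add: that_def qmink_act.abs_eq falg_act_fgen)

lemma qmink_act_1: "qmink_act 1 \<phi> = \<phi>"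
  using qmink_act_qconst[of 1 \<phi>] by simp

lemma qmink_act_power: "qmink_act (that g ^ n) = gen_act g ^^ n"
  by (induction n)
    (auto simp: fun_eq_iff qmink_act_1 qmink_act_mult qmink_act_that funpow_swap1 power_commutes)

text \<open>At zero in the earlier slots all powers of \<open>q\<close> are 1 and the
  \<open>F\<close> term vanishes, so each generator is a pure shift of its own slot.\<close>

lemma gen_act_funpow:
  "(gen_act G41 ^^ n) \<phi> 0 b c d = \<phi> n b c d"
  "(gen_act G42 ^^ n) \<phi> 0 0 c d = \<phi> 0 n c d"
  "(gen_act G31 ^^ n) \<phi> 0 0 0 d = \<phi> 0 0 n d"
  "(gen_act G32 ^^ n) \<phi> 0 0 0 0 = \<phi> 0 0 0 n"
  by (induction n arbitrary: \<phi>) (simp_all add: funpow_Suc_right del: funpow.simps(2))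

lemma qmink_act_ordered_monomial:
  "qmink_act (that G41 ^ a * that G42 ^ b * that G31 ^ c * that G32 ^ d) \<phi> 0 0 0 0 = \<phi> a b c d"
  by (simp add: qmink_act_mult qmink_act_power gen_act_funpow)

lemma qmink_act_Q:
  "qmink_act (Q f) \<phi> 0 0 0 0 = (\<Sum>e\<in>Poly_Mapping.keys f. Poly_Mapping.lookup f e *
     \<phi> (Poly_Mapping.lookup e G41) (Poly_Mapping.lookup e G42)
       (Poly_Mapping.lookup e G31) (Poly_Mapping.lookup e G32))"
  by (simp add: Q_def qmink_act_sum qmink_act_mult[of "qconst _"] qmink_act_qconst
      qmink_act_ordered_monomial)

lemma gen_all: "(\<forall>g. P g) \<longleftrightarrow> P G41 \<and> P G42 \<and> P G31 \<and> P G32"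
  by (metis gen.exhaust)

lemma Q_inj: "inj Q"
proof (rule injI)
  fix f g assume fg: "Q f = Q g"
  show "f = g"
  proof (rule poly_mapping_eqI)
    fix e :: "gen \<Rightarrow>\<^sub>0 nat"
    \<comment> \<open>The indicator of \<open>e\<close> makes the action of \<open>Q h\<close>,
      evaluated at the origin, return the coefficient of \<open>h\<close> at
      \<open>e\<close>.\<close>
    define \<delta> :: exponent_fun where "\<delta> = (\<lambda>a b c d.
      if a = Poly_Mapping.lookup e G41 \<and> b = Poly_Mapping.lookup e G42 \<and>
         c = Poly_Mapping.lookup e G31 \<and> d = Poly_Mapping.lookup e G32 then 1 else 0)"
    have \<delta>: "\<delta> (Poly_Mapping.lookup e' G41) (Poly_Mapping.lookup e' G42)
        (Poly_Mapping.lookup e' G31) (Poly_Mapping.lookup e' G32) = (if e' = e then 1 else 0)" for e'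
      using gen_all[of "\<lambda>g. Poly_Mapping.lookup e' g = Poly_Mapping.lookup e g"]
      by (simp add: \<delta>_def poly_mapping_eq_iff fun_eq_iff)
    have mult_if_delta: "x * (if e' = e then 1 else 0) = (if e' = e then x else 0)" for e' and x :: Cq
      by simp
    have "Poly_Mapping.lookup h e = qmink_act (Q h) \<delta> 0 0 0 0" for h
      by (simp add: qmink_act_Q \<delta> mult_if_delta in_keys_iff)
    then show "Poly_Mapping.lookup f e = Poly_Mapping.lookup g e" by (simp add: fg)
  qed
qed

subsection \<open>Reordering products of generators\<close>

abbreviation qq :: "int \<Rightarrow> qmink" where
  "qq k \<equiv> qconst (qpow k)"

lemma qq_add: "qq (j + k) = qq j * qq k"
  by (simp add: qpow_add qconst_mult)

lemma q_commute_power_right: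
  assumes "x * y = qq k * y * x"
  shows "x * y ^ n = qq (k * int n) * y ^ n * x"
proof (induction n)
  case (Suc n)
  have "x * y ^ Suc n = (x * y) * y ^ n" by (simp add: mult.assoc)
  also have "\<dots> = qq k * y * (x * y ^ n)" by (simp add: assms mult.assoc)
  also have "\<dots> = qq k * (y * qq (k * int n)) * y ^ n * x" by (simp add: Suc mult.assoc)
  also have "\<dots> = qq (k * int (Suc n)) * y ^ Suc n * x"
    by (simp add: qconst_central[of _ y, symmetric] distrib_left qq_add mult.assoc)
  finally show ?case .
qed simp

lemma q_commute_power_left:
  assumes "x * y = qq k * y * x"
  shows "x ^ n * y = qq (k * int n) * y * x ^ n"
proof (induction n)
  case (Suc n)
  have "x ^ Suc n * y = x * (x ^ n * y)" by (simp add: mult.assoc)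
  also have "\<dots> = (x * qq (k * int n)) * y * x ^ n" by (simp add: Suc mult.assoc)
  also have "\<dots> = qq (k * int n) * (x * y) * x ^ n"
    by (simp add: qconst_central[of _ x, symmetric] mult.assoc)
  also have "\<dots> = (qq (k * int n) * qq k) * y * (x * x ^ n)" by (simp add: assms mult.assoc)
  also have "\<dots> = qq (k * int (Suc n)) * y * x ^ Suc n"
    by (simp add: distrib_left add.commute flip: qq_add)
  finally show ?case .
qed simp

lemma q_commute_powers:
  assumes "x * y = qq k * y * x"
  shows "x ^ m * y ^ n = qq (k * int m * int n) * y ^ n * x ^ m"
  using q_commute_power_right[OF q_commute_power_left[OF assms, of m], of n] .

lemma that_power_commute:
  "that G42 ^ m * that G41 ^ n = qq (- int m * int n) * that G41 ^ n * that G42 ^ m"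
  "that G31 ^ m * that G41 ^ n = qq (- int m * int n) * that G41 ^ n * that G31 ^ m"
  "that G31 ^ m * that G42 ^ n = that G42 ^ n * that G31 ^ m"
  "that G32 ^ m * that G42 ^ n = qq (- int m * int n) * that G42 ^ n * that G32 ^ m"
  "that G32 ^ m * that G31 ^ n = qq (- int m * int n) * that G31 ^ n * that G32 ^ m"
  using q_commute_powers[of "that G42" "that G41" "-1" m n]
    q_commute_powers[of "that G31" "that G41" "-1" m n]
    q_commute_powers[of "that G31" "that G42" "0" m n]
    q_commute_powers[of "that G32" "that G42" "-1" m n]
    q_commute_powers[of "that G32" "that G31" "-1" m n]
  by (simp_all add: that_relations)

lemma qconst_left: "x * (qconst c * y) = qconst c * (x * y)"
  by (metis mult.assoc qconst_central)

lemma qconst_merge: "qconst c * (qconst d * x) = qconst (c * d) * x"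
  by (simp add: qconst_mult mult.assoc)

lemma G42_G31_G41_power:
  "that G42 ^ j * that G31 ^ k * that G41 ^ n =
     qq (- int n * int j - int n * int k) * that G41 ^ n * that G42 ^ j * that G31 ^ k"
proof -
  have "that G42 ^ j * that G31 ^ k * that G41 ^ n =
      qq (- int k * int n) * ((that G42 ^ j * that G41 ^ n) * that G31 ^ k)"
    by (simp add: mult.assoc that_power_commute(2) qconst_left)
  then show ?thesis
    by (simp add: that_power_commute(1) mult.assoc qconst_merge algebra_simps flip: qpow_add)
qed

lemma G32_G42_G31_power:
  "that G32 ^ n * (that G42 ^ j * that G31 ^ k) =
     qq (- int j * int n - int k * int n) * that G42 ^ j * that G31 ^ k * that G32 ^ n"
proof -
  have "that G32 ^ n * (that G42 ^ j * that G31 ^ k) =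
      (that G32 ^ n * that G42 ^ j) * that G31 ^ k"
    by (simp add: mult.assoc)
  also have "\<dots> = qq (- int n * int j) * (that G42 ^ j * (that G32 ^ n * that G31 ^ k))"
    by (simp add: that_power_commute(4) mult.assoc)
  finally show ?thesis
    by (simp add: that_power_commute(5) qconst_left[of "that g ^ e" for g e] qconst_merge
        algebra_simps flip: qpow_add)
qed

text \<open>Passing one factor \<open>that G41\<close> leaves an extra term in which
  \<open>that G42 * that G31\<close> must still cross the other \<open>n\<close> factors, at cost
  \<open>qpow (- 2 * int n)\<close>. The coefficients thus add up by \<open>F_add_1\<close>.\<close>

lemma G32_G41_power:
  "that G32 * that G41 ^ n =
     that G41 ^ n * that G32 + qconst (F (int n)) * (that G41 ^ (n - 1) * that G42 * that G31)"
proof (induction n)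
  case (Suc n)
  let ?A = "that G41" and ?B = "that G42" and ?C = "that G31" and ?D = "that G32"
  \<comment> \<open>For \<open>n = 0\<close> the powers differ because of truncation, but then the
    coefficient is \<open>F 0 = 0\<close>.\<close>
  have shift: "?A * (qconst (F (int n)) * (?A ^ (n - 1) * ?B * ?C)) =
      qconst (F (int n)) * (?A ^ n * ?B * ?C)"
    by (cases n) (simp_all add: qconst_left mult.assoc)
  have "?D * ?A ^ Suc n = (?D * ?A) * ?A ^ n" by (simp add: mult.assoc)
  also have "\<dots> = ?A * (?D * ?A ^ n) + qconst (qpow (- 1) - qpow 1) * (?B * ?C * ?A ^ n)"
    by (simp add: that_relations distrib_right mult.assoc)
  also have "?B * ?C * ?A ^ n = qq (- 2 * int n) * (?A ^ n * ?B * ?C)"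
    using G42_G31_G41_power[of 1 1 n] by (simp add: mult.assoc)
  also have "?A * (?D * ?A ^ n) = ?A ^ Suc n * ?D + qconst (F (int n)) * (?A ^ n * ?B * ?C)"
    unfolding Suc distrib_left shift by (simp add: mult.assoc)
  finally show ?case
    by (simp add: F_add_1 qconst_merge qconst_add distrib_right add.assoc
        mult.commute[of "qpow (-1) - _"])
qed simp

section \<open>The coefficients \<open>Fk\<close> and powers of \<open>that G32\<close> past powers
  of \<open>that G41\<close>\<close>

lemma Fk_0 [simp]: "Fk 0 d m = 1"
  by (simp add: Fk_def beta_eq_1)

lemma Fk_Suc:
  "Fk (Suc k) (Suc d) m = Fk k d m * F (int m - int k) + qpow (- 2 * int (Suc k)) * Fk (Suc k) d m"
  by (simp add: Fk_def algebra_simps)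

text \<open>For \<open>k > m\<close> the product contains the factor \<open>F 0\<close>; for
  \<open>k > d\<close> already \<open>beta\<close> vanishes.\<close>

lemma Fk_eq_0: "k > d \<or> k > m \<Longrightarrow> Fk k d m = 0"
proof (elim disjE)
  assume "k > m"
  then have "(\<Prod>l<k. F (int m - int l)) = 0"
    by (intro prod_zero) (auto intro!: bexI[of _ m])
  then show ?thesis by (simp add: Fk_def)
qed (simp add: Fk_def beta_eq_0)

text \<open>One more \<open>that G32\<close> either crosses the whole \<open>k\<close>-th term,
  paying \<open>qpow (- 2 * int k)\<close> at the middle block, or turns one \<open>that G41\<close>
  into a new pair with factor \<open>F (int m - int k)\<close>. This is the recursion
  \<open>Fk_Suc\<close>.\<close>

lemma G32_power_G41_power:
  "that G32 ^ d * that G41 ^ m =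
     (\<Sum>k\<le>d. qconst (Fk k d m) *
        (that G41 ^ (m - k) * (that G42 ^ k * that G31 ^ k) * that G32 ^ (d - k)))"
proof (induction d)
  case (Suc d)
  let ?A = "that G41" and ?B = "that G42" and ?C = "that G31" and ?D = "that G32"
  let ?M = "\<lambda>k d. ?A ^ (m - k) * (?B ^ k * ?C ^ k) * ?D ^ d"
  have step: "qconst (Fk k d m) * (?D * ?M k (d - k)) =
      qconst (qpow (- 2 * int k) * Fk k d m) * ?M k (Suc d - k)
      + qconst (Fk k d m * F (int m - int k)) * ?M (Suc k) (d - k)" if "k \<le> d" for k
  proof (cases "k \<le> m")
    case True
    have BC: "?B * (?C * (?B ^ k * ?C ^ k)) = ?B ^ Suc k * ?C ^ Suc k"
      using that_power_commute(3)[of 1 k] by (simp add: mult.assoc) (metis mult.assoc)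
    have DBC: "?D * (?B ^ k * ?C ^ k) = qq (- 2 * int k) * (?B ^ k * ?C ^ k) * ?D"
      using G32_G42_G31_power[of 1 k k] by (simp add: mult.assoc)
    have "?D * ?M k (d - k) = (?D * ?A ^ (m - k)) * (?B ^ k * ?C ^ k) * ?D ^ (d - k)"
      by (simp add: mult.assoc)
    also have "\<dots> = ?A ^ (m - k) * (?D * (?B ^ k * ?C ^ k)) * ?D ^ (d - k) +
       qconst (F (int m - int k)) * (?A ^ (m - Suc k) * (?B * (?C * (?B ^ k * ?C ^ k))) * ?D ^ (d - k))"
      using True by (simp add: G32_G41_power distrib_right mult.assoc of_nat_diff)
    also have "\<dots> = qq (- 2 * int k) * ?M k (Suc d - k) + qconst (F (int m - int k)) * ?M (Suc k) (d - k)"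
      unfolding DBC BC using that by (simp add: mult.assoc qconst_left Suc_diff_le)
    finally show ?thesis by (simp only: distrib_left qconst_merge mult.commute)
  qed (simp add: Fk_eq_0)
  have "?D ^ Suc d * ?A ^ m = ?D * (?D ^ d * ?A ^ m)" by (simp add: mult.assoc)
  also have "\<dots> = (\<Sum>k\<le>d. qconst (Fk k d m) * (?D * ?M k (d - k)))"
    by (simp add: Suc sum_distrib_left qconst_left)
  also have "\<dots> = (\<Sum>k\<le>d. qconst (qpow (- 2 * int k) * Fk k d m) * ?M k (Suc d - k))
      + (\<Sum>k\<le>d. qconst (Fk k d m * F (int m - int k)) * ?M (Suc k) (d - k))"
    by (simp add: step sum.distrib)
  \<comment> \<open>The added term at \<open>Suc d\<close> is zero; it makes the index shift line
    this sum up with the other one.\<close>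
  also have "(\<Sum>k\<le>d. qconst (qpow (- 2 * int k) * Fk k d m) * ?M k (Suc d - k)) =
      (\<Sum>k\<le>Suc d. qconst (qpow (- 2 * int k) * Fk k d m) * ?M k (Suc d - k))"
    by (simp add: Fk_eq_0)
  also have "\<dots> = ?M 0 (Suc d) +
      (\<Sum>k\<le>d. qconst (qpow (- 2 * int (Suc k)) * Fk (Suc k) d m) * ?M (Suc k) (d - k))"
    by (subst sum.atMost_Suc_shift) simp
  also have "\<dots> + (\<Sum>k\<le>d. qconst (Fk k d m * F (int m - int k)) * ?M (Suc k) (d - k)) =
      ?M 0 (Suc d) + (\<Sum>k\<le>d. qconst (Fk (Suc k) (Suc d) m) * ?M (Suc k) (d - k))"
    by (simp only: Fk_Suc qconst_add distrib_right sum.distrib add_ac)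
  also have "\<dots> = (\<Sum>k\<le>Suc d. qconst (Fk k (Suc d) m) * ?M k (Suc d - k))"
    by (subst sum.atMost_Suc_shift) simp
  finally show ?case .
qed simp

section \<open>The star product of two monomials\<close>

lemma Q_sum: "Q (sum f S) = (\<Sum>i\<in>S. Q (f i))"
proof (induction S rule: infinite_finite_induct)
qed (simp_all add: Q_add, simp_all add: Q_def)

theorem theorem4p4:
  fixes a b c d m n p r :: nat
  shows "(t G41 ^ a * t G42 ^ b * t G31 ^ c * t G32 ^ d) \<star>
         (t G41 ^ m * t G42 ^ n * t G31 ^ p * t G32 ^ r) =
      cconst (qpow (- int m * int c - int m * int b - int n * int d - int d * int p)) *
        (t G41 ^ (a + m) * t G42 ^ (b + n) * t G31 ^ (c + p) * t G32 ^ (d + r))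
    + (\<Sum>k = 1..min d m.
        cconst (qpow (- (int m - int k) * int c - (int m - int k) * int b
                      - int n * (int d - int k) - int p * (int d - int k)) * Fk k d m) *
        (t G41 ^ (a + m - k) * t G42 ^ (b + k + n) * t G31 ^ (c + k + p) * t G32 ^ (d - k + r)))"
    (is "?f \<star> ?g = ?head + (\<Sum>k = 1..min d m. ?T k)")
proof -
  let ?A = "that G41" and ?B = "that G42" and ?C = "that G31" and ?D = "that G32"
  let ?M = "\<lambda>k. ?A ^ a * (?B ^ b * ?C ^ c) *
      (?A ^ (m - k) * (?B ^ k * ?C ^ k) * ?D ^ (d - k)) * (?B ^ n * ?C ^ p) * ?D ^ r"
  \<comment> \<open>Within each term only \<open>q\<close>-commutations remain: the left block
    crosses \<open>?A ^ (m - k)\<close>, and \<open>?D ^ (d - k)\<close> crosses the right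
    block.\<close>
  have T: "qconst (Fk k d m) * ?M k = Q (?T k)" if "k \<le> min d m" for k
  proof -
    have "?M k = ?A ^ a * (?B ^ b * ?C ^ c * ?A ^ (m - k)) * (?B ^ k * ?C ^ k) *
        (?D ^ (d - k) * (?B ^ n * ?C ^ p)) * ?D ^ r"
      by (simp add: mult.assoc)
    also have "\<dots> = qq (- int (m - k) * int b - int (m - k) * int c) *
        (qq (- int n * int (d - k) - int p * int (d - k)) *
        ((?A ^ a * ?A ^ (m - k)) * (?B ^ b * ((?C ^ c * ?B ^ k) * (?C ^ k * ?B ^ n) * ?C ^ p)) *
          (?D ^ (d - k) * ?D ^ r)))"
      unfolding G42_G31_G41_power G32_G42_G31_power
      by (simp only: mult.assoc qconst_left[of "that g ^ e" for g e])
    \<comment> \<open>\<open>?B\<close> and \<open>?C\<close> commute, so collecting their powers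
      costs no power of \<open>q\<close>.\<close>
    also have "?B ^ b * ((?C ^ c * ?B ^ k) * (?C ^ k * ?B ^ n) * ?C ^ p) =
        ?B ^ (b + k) * (?C ^ (c + k) * ?B ^ n) * ?C ^ p"
      unfolding that_power_commute(3)[of c k] by (simp only: power_add mult.assoc)
    also have "\<dots> = ?B ^ (b + k + n) * ?C ^ (c + k + p)"
      unfolding that_power_commute(3) by (simp only: power_add mult.assoc)
    also have "?A ^ a * ?A ^ (m - k) = ?A ^ (a + m - k)"
      using that by (simp flip: power_add)
    also have "?D ^ (d - k) * ?D ^ r = ?D ^ (d - k + r)"
      by (simp add: power_add)
    finally have "qconst (Fk k d m) * ?M k =
       qconst (Fk k d m * (qpow (- int (m - k) * int b - int (m - k) * int c) *
         qpow (- int n * int (d - k) - int p * int (d - k)))) *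
       (?A ^ (a + m - k) * ?B ^ (b + k + n) * ?C ^ (c + k + p) * ?D ^ (d - k + r))"
      by (simp only: qconst_merge mult.assoc)
    also have "qpow (- int (m - k) * int b - int (m - k) * int c) *
         qpow (- int n * int (d - k) - int p * int (d - k)) =
       qpow (- (int m - int k) * int c - (int m - int k) * int b
                      - int n * (int d - int k) - int p * (int d - int k))"
      using that by (simp add: of_nat_diff algebra_simps flip: qpow_add)
    finally show ?thesis
      by (simp only: Q_cconst_mult Q_monomial mult.commute[of "Fk k d m"])
  qed
  \<comment> \<open>The grouping isolates \<open>?D ^ d * ?A ^ m\<close>, the only crossing that
    creates new monomials.\<close>
  have "Q ?f * Q ?g = ?A ^ a * (?B ^ b * ?C ^ c) * (?D ^ d * ?A ^ m) * (?B ^ n * ?C ^ p) * ?D ^ r"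
    unfolding Q_monomial by (simp only: mult.assoc)
  also have "\<dots> = (\<Sum>k\<le>d. qconst (Fk k d m) * ?M k)"
    unfolding G32_power_G41_power
    by (simp only: sum_distrib_left sum_distrib_right mult.assoc
        qconst_left[of "that g ^ e" for g e])
  also have "\<dots> = (\<Sum>k\<le>min d m. qconst (Fk k d m) * ?M k)"
    by (intro sum.mono_neutral_right ballI) (auto simp: Fk_eq_0 not_le)
  also have "\<dots> = (\<Sum>k\<le>min d m. Q (?T k))"
    by (intro sum.cong refl T) (simp only: atMost_iff)
  finally have *: "Q ?f * Q ?g = (\<Sum>k\<le>min d m. Q (?T k))" .
  \<comment> \<open>The leading term is the case \<open>k = 0\<close>, where \<open>Fk\<close>
    equals 1.\<close>
  have "?T 0 = ?head"
    by (simp add: mult.commute[of "int d"])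
  then have "(\<Sum>k\<le>min d m. ?T k) = ?head + (\<Sum>k = 1..min d m. ?T k)"
    by (simp only: atMost_atLeast0 sum.atLeast_Suc_atMost[OF le0] One_nat_def)
  then show ?thesis
    unfolding star_def * Q_sum[symmetric] by (simp only: inv_f_f[OF Q_inj])
qed

end
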